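(* (i) Every connected graph $G$ of order $n$ and minimum degree $\delta$ has a connected two-step dominating set $D$ with $|D| \leq \frac{3(n - |N^2(D)|)}{\delta + 1} - 2$. (ii) Every connected graph $G$ of order $n \geq 4$ and minimum degree $\delta$ has a connected two-way two-step dominating set $D'$ with $|D'| \leq \frac{3n}{\delta + 1} - 2$. Moreover, for every $\delta \geq 2$, there exist infinitely many connected graphs $G$ of minimum degree $\delta$, with order $n$, such that $\gamma^2_c(G) \geq \frac{3(n-2)}{\delta + 1} - 4$.
   Context: Graphs are finite and simple. For $S\subseteq V(G)$, $N^k(S)$ is the set of vertices at distance exactly $k$ from $S$. A set $D$ is a two-step dominating set if every vertex is at distance at most $2$ from $D$; it is connected if $G[D]$ is connected. $\gamma^2_c(G)$ is the minimum cardinality of a connected two-step dominating set of $G$. A connected two-step dominating set $D$ is a connected two-way two-step dominating set if (i) every pendant (degree-$1$) vertex of $G$ belongs to $D$, and (ii) every vertex of $N^2(D)$ has at least two neighbours in $N^1(D)$. *)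

theory Defs
  imports "Graph_Theory.Graph_Theory"
begin

text \<open>
  Finite simple graphs are the locale \<^locale>\<open>pair_graph\<close>: finite, loop-free, symmetric
  digraphs without parallel arcs. An edge is a pair of opposite arcs, so the degree of a vertex is
  its out-degree. \<open>Digraph_Component.connected\<close> excludes the graph without vertices.
\<close>

definition order :: "'a pair_pre_digraph \<Rightarrow> nat" where
  "order G = card (pverts G)"

definition degree :: "'a pair_pre_digraph \<Rightarrow> 'a \<Rightarrow> nat" where
  "degree G v = out_degree (with_proj G) v"

definition min_degree :: "'a pair_pre_digraph \<Rightarrow> nat" where
  "min_degree G = Min (degree G ` pverts G)"

definition connected_graph :: "'a pair_pre_digraph \<Rightarrow> bool" where
  "connected_graph G \<longleftrightarrow> pair_graph G \<and> Digraph_Component.connected (with_proj G)"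

text \<open>Shortest paths with unit weights; the distance is \<open>\<infinity>\<close> if there is no path.\<close>

definition gdist :: "'a pair_pre_digraph \<Rightarrow> 'a \<Rightarrow> 'a \<Rightarrow> ereal" where
  "gdist G u v = wf_digraph.\<mu> (with_proj G) (\<lambda>_. 1) u v"

text \<open>The distance from the empty set is \<open>\<infinity>\<close>.\<close>

definition set_dist :: "'a pair_pre_digraph \<Rightarrow> 'a set \<Rightarrow> 'a \<Rightarrow> ereal" where
  "set_dist G S v = (INF u\<in>S. gdist G u v)"

definition nbhd :: "'a pair_pre_digraph \<Rightarrow> nat \<Rightarrow> 'a set \<Rightarrow> 'a set" where
  "nbhd G k S = {v \<in> pverts G. set_dist G S v = ereal (real k)}"

definition two_step_dominating :: "'a pair_pre_digraph \<Rightarrow> 'a set \<Rightarrow> bool" where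
  "two_step_dominating G D \<longleftrightarrow> D \<subseteq> pverts G \<and> (\<forall>v\<in>pverts G. set_dist G D v \<le> 2)"

definition connected_two_step_dominating :: "'a pair_pre_digraph \<Rightarrow> 'a set \<Rightarrow> bool" where
  "connected_two_step_dominating G D \<longleftrightarrow>
     two_step_dominating G D \<and> Digraph_Component.connected (with_proj G \<restriction> D)"

definition gamma2c :: "'a pair_pre_digraph \<Rightarrow> nat" where
  "gamma2c G = Min (card ` {D. connected_two_step_dominating G D})"

definition connected_two_way_two_step_dominating ::
    "'a pair_pre_digraph \<Rightarrow> 'a set \<Rightarrow> bool" where
  "connected_two_way_two_step_dominating G D \<longleftrightarrow>
     connected_two_step_dominating G D \<and>
     (\<forall>v\<in>pverts G. degree G v = 1 \<longrightarrow> v \<in> D) \<and>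
     (\<forall>v\<in>nbhd G 2 D. 2 \<le> card {u \<in> nbhd G 1 D. (v, u) \<in> parcs G})"

end

theory Submission
  imports Defs
begin

text \<open>
  Write \<open>N[D]\<close> for the closed neighbourhood of \<open>D\<close>. Among the connected sets \<open>D\<close> with
  \<open>(|D| + 2) (\<delta> + 1) \<le> 3 |N[D]|\<close>, such as single vertices, choose one with \<open>|N[D]|\<close> maximal.
  If a vertex \<open>v\<close> has distance 3 from \<open>D\<close>, then adding a shortest path to \<open>v\<close> costs 3 vertices, but
  \<open>N[D]\<close> gains all of \<open>N[v]\<close>, that is at least \<open>\<delta> + 1\<close> vertices. If \<open>v\<close> has distance 2 and only one
  neighbour in \<open>N\<^sup>1(D)\<close>, then adding both costs 2 vertices and gains at least \<open>\<delta>\<close>, which suffices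
  because \<open>2 (\<delta> + 1) \<le> 3 \<delta>\<close> for \<open>\<delta> \<ge> 2\<close>. For \<open>\<delta> \<le> 1\<close> the set of all vertices satisfies the two-way
  bound.

  For the lower bound take a chain of layers with three consecutive layers containing \<open>\<delta> + 1\<close>
  vertices, adjacency meaning that layers differ by at most one. A connected two-step dominating
  set meets all layers except the outer two on either side.
\<close>

section \<open>Closed neighbourhoods and distances\<close>

text \<open>The iterates \<open>closed_nbhd G ^^ k\<close> are the balls of radius \<open>k\<close>
  around \<open>D\<close>, so distance conditions turn into equations between sets.\<close>

definition closed_nbhd :: "'a pair_pre_digraph \<Rightarrow> 'a set \<Rightarrow> 'a set" where
  "closed_nbhd G D = D \<union> parcs G `` D"

lemma (in pair_wf_digraph) closed_nbhd_subset:
  "D \<subseteq> pverts G \<Longrightarrow> closed_nbhd G D \<subseteq> pverts G"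
  by (auto simp: closed_nbhd_def dest: in_arcsD2)

lemma (in pair_wf_digraph) closed_nbhd_pow_subset:
  "D \<subseteq> pverts G \<Longrightarrow> (closed_nbhd G ^^ k) D \<subseteq> pverts G"
  by (induction k) (simp_all add: closed_nbhd_subset)

text \<open>The outermost application of \<open>closed_nbhd\<close> corresponds to the last arc of a
  walk. Walks are bounded by \<open>k\<close> instead of having length \<open>k\<close> because each
  application keeps the vertices reached before. The hypothesis on \<open>D\<close> concerns the
  empty walk, which must sit at a vertex of the graph.\<close>

lemma (in pair_wf_digraph) closed_nbhd_pow_iff_awalk:
  assumes "D \<subseteq> pverts G"
  shows "v \<in> (closed_nbhd G ^^ k) D \<longleftrightarrow> (\<exists>u\<in>D. \<exists>p. awalk u p v \<and> length p \<le> k)"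
proof (induction k arbitrary: v)
  case 0
  then show ?case using assms by (auto simp: awalk_Nil_iff)
next
  case (Suc k)
  show ?case
  proof
    assume "v \<in> (closed_nbhd G ^^ Suc k) D"
    then consider "v \<in> (closed_nbhd G ^^ k) D"
      | x where "x \<in> (closed_nbhd G ^^ k) D" "(x, v) \<in> parcs G"
      by (auto simp: closed_nbhd_def)
    then show "\<exists>u\<in>D. \<exists>p. awalk u p v \<and> length p \<le> Suc k"
    proof cases
      case 1
      then show ?thesis using Suc.IH le_SucI by blast
    next
      case 2
      then obtain u p where up: "u \<in> D" "awalk u p x" "length p \<le> k"
        using Suc.IH by blast
      then have "awalk u (p @ [(x, v)]) v"
        using 2 by (auto simp: awalk_simps dest: in_arcsD1 in_arcsD2)
      then show ?thesis using up by (intro bexI exI[of _ "p @ [(x, v)]"]) auto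
    qed
  next
    assume "\<exists>u\<in>D. \<exists>p. awalk u p v \<and> length p \<le> Suc k"
    then obtain u p where up: "u \<in> D" "awalk u p v" "length p \<le> Suc k" by blast
    show "v \<in> (closed_nbhd G ^^ Suc k) D"
    proof (cases p rule: rev_cases)
      case Nil
      then have "v \<in> (closed_nbhd G ^^ k) D" using up Suc.IH by force
      then show ?thesis by (auto simp: closed_nbhd_def)
    next
      case (snoc q e)
      obtain x y where [simp]: "e = (x, y)" by (cases e)
      have "awalk u q x" "y = v" "(x, v) \<in> parcs G"
        using up snoc by (auto simp: awalk_simps)
      moreover have "length q \<le> k" using up snoc by simp
      ultimately have "x \<in> (closed_nbhd G ^^ k) D" "(x, v) \<in> parcs G"
        using Suc.IH up by blast+
      then show ?thesis by (auto simp: closed_nbhd_def)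
    qed
  qed
qed

lemma (in pair_wf_digraph) set_dist_le_walk:
  assumes "u \<in> D" "awalk u p v"
  shows "set_dist G D v \<le> ereal (real (length p))"
proof -
  have "\<mu> (\<lambda>_. 1) u v \<le> awalk_cost (\<lambda>_. 1) p"
    using assms by (intro min_cost_le_walk_cost)
  then have "gdist G u v \<le> ereal (real (length p))"
    by (simp add: gdist_def awalk_cost_def sum_list_triv)
  then show ?thesis
    unfolding set_dist_def using assms by (intro INF_lower2)
qed

lemma (in pair_wf_digraph) set_dist_ge:
  assumes "\<And>u p. u \<in> D \<Longrightarrow> awalk u p v \<Longrightarrow> k \<le> length p"
  shows "ereal (real k) \<le> set_dist G D v"
  unfolding set_dist_def gdist_def \<mu>_def
  using assms by (auto intro!: INF_greatest simp: awalk_cost_def sum_list_triv)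

text \<open>Walk lengths are integers, so no distance lies strictly between \<open>k\<close> and
  \<open>k + 1\<close>. An unreachable \<open>v\<close> is included, its distance being
  infinite.\<close>

lemma (in pair_wf_digraph) not_closed_nbhd_pow_dist:
  assumes "D \<subseteq> pverts G" "v \<notin> (closed_nbhd G ^^ k) D"
  shows "ereal (real (Suc k)) \<le> set_dist G D v"
  using assms by (intro set_dist_ge) (auto simp: closed_nbhd_pow_iff_awalk not_less_eq_eq)

lemma (in pair_wf_digraph) set_dist_le_iff:
  assumes "D \<subseteq> pverts G"
  shows "set_dist G D v \<le> ereal (real k) \<longleftrightarrow> v \<in> (closed_nbhd G ^^ k) D"
proof
  assume *: "set_dist G D v \<le> ereal (real k)"
  show "v \<in> (closed_nbhd G ^^ k) D"
  proof (rule ccontr)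
    assume "v \<notin> (closed_nbhd G ^^ k) D"
    from order_trans[OF not_closed_nbhd_pow_dist[OF assms this] *] show False by simp
  qed
next
  assume "v \<in> (closed_nbhd G ^^ k) D"
  then obtain u p where "u \<in> D" "awalk u p v" "length p \<le> k"
    using closed_nbhd_pow_iff_awalk[OF assms] by blast
  moreover from this have "ereal (real (length p)) \<le> ereal (real k)" by simp
  ultimately show "set_dist G D v \<le> ereal (real k)"
    using set_dist_le_walk order_trans by blast
qed

text \<open>Inside the larger ball the distance is at most \<open>Suc k\<close>, and outside the
  smaller one it is at least \<open>Suc k\<close>.\<close>

lemma (in pair_wf_digraph) nbhd_Suc_eq:
  assumes "D \<subseteq> pverts G"
  shows "nbhd G (Suc k) D = (closed_nbhd G ^^ Suc k) D - (closed_nbhd G ^^ k) D"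
proof -
  have "set_dist G D v = ereal (real (Suc k)) \<longleftrightarrow>
      v \<in> (closed_nbhd G ^^ Suc k) D - (closed_nbhd G ^^ k) D" for v
    using set_dist_le_iff[OF assms, of v k] set_dist_le_iff[OF assms, of v "Suc k"]
      not_closed_nbhd_pow_dist[OF assms, of v k]
    by (cases "set_dist G D v") auto
  then show ?thesis
    using closed_nbhd_pow_subset[OF assms, of "Suc k"] unfolding nbhd_def by blast
qed

lemma (in pair_wf_digraph) nbhd_1_eq:
  "D \<subseteq> pverts G \<Longrightarrow> nbhd G 1 D = closed_nbhd G D - D"
  using nbhd_Suc_eq[of D 0] by simp

lemma (in pair_wf_digraph) nbhd_2_eq:
  "D \<subseteq> pverts G \<Longrightarrow> nbhd G 2 D = closed_nbhd G (closed_nbhd G D) - closed_nbhd G D"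
  using nbhd_Suc_eq[of D 1] by (simp add: numeral_2_eq_2)

lemma (in pair_wf_digraph) two_step_dominating_iff:
  "two_step_dominating G D \<longleftrightarrow>
    D \<subseteq> pverts G \<and> closed_nbhd G (closed_nbhd G D) = pverts G"
proof (cases "D \<subseteq> pverts G")
  case True
  have "set_dist G D v \<le> 2 \<longleftrightarrow> v \<in> closed_nbhd G (closed_nbhd G D)" for v
    using set_dist_le_iff[OF True, of v 2] by (simp add: numeral_2_eq_2)
  then show ?thesis
    using True closed_nbhd_subset[OF closed_nbhd_subset[OF True]]
    by (auto simp: two_step_dominating_def)
qed (simp add: two_step_dominating_def)

section \<open>Connectedness by cuts\<close>

text \<open>Connectedness is by definition strong connectedness of the symmetric closure. A set
  closed under arcs in both directions contains all that is reachable from it; conversely, the set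
  reachable from a vertex is closed in this sense. The cut form avoids walks inside induced
  subgraphs.\<close>

lemma (in wf_digraph) connected_iff_cut:
  "Digraph_Component.connected G \<longleftrightarrow> verts G \<noteq> {} \<and>
    (\<forall>A\<subseteq>verts G. A \<noteq> {} \<longrightarrow> (\<forall>e\<in>arcs G. tail G e \<in> A \<longleftrightarrow> head G e \<in> A) \<longrightarrow> A = verts G)"
proof -
  let ?H = "with_proj (mk_symmetric G)"
  interpret H: pair_wf_digraph "mk_symmetric G" ..
  have verts: "pverts (mk_symmetric G) = verts G" by (simp add: mk_symmetric_def)
  have arc: "(x, y) \<in> parcs (mk_symmetric G) \<longleftrightarrow>
      (\<exists>e\<in>arcs G. (tail G e = x \<and> head G e = y) \<or> (head G e = x \<and> tail G e = y))" for x y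
    by (auto simp: mk_symmetric_def)
  have arcI: "(tail G e, head G e) \<in> parcs (mk_symmetric G)"
    "(head G e, tail G e) \<in> parcs (mk_symmetric G)" if "e \<in> arcs G" for e
    using that unfolding arc by blast+
  show ?thesis
  proof (intro iffI conjI allI impI)
    assume *: "Digraph_Component.connected G"
    then show "verts G \<noteq> {}"
      by (simp add: Digraph_Component.connected_def strongly_connected_def verts)
    fix A assume A: "A \<subseteq> verts G" "A \<noteq> {}" "\<forall>e\<in>arcs G. tail G e \<in> A \<longleftrightarrow> head G e \<in> A"
    then obtain a where a: "a \<in> A" by blast
    have "x \<in> A" if "x \<in> verts G" for x
    proof -
      have "a \<rightarrow>\<^sup>*\<^bsub>?H\<^esub> x"
        using * a A(1) that
        by (auto simp: Digraph_Component.connected_def strongly_connected_def verts)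
      then show "x \<in> A"
      proof (induction rule: H.reachable_induct)
        case base
        then show ?case using a by simp
      next
        case (step x y)
        then show ?case using A(3) arc by auto
      qed
    qed
    then show "A = verts G" using A(1) by blast
  next
    assume *: "verts G \<noteq> {} \<and> (\<forall>A\<subseteq>verts G. A \<noteq> {} \<longrightarrow>
      (\<forall>e\<in>arcs G. tail G e \<in> A \<longleftrightarrow> head G e \<in> A) \<longrightarrow> A = verts G)"
    have "u \<rightarrow>\<^sup>*\<^bsub>?H\<^esub> v" if uv: "u \<in> verts G" "v \<in> verts G" for u v
    proof -
      let ?A = "{x. u \<rightarrow>\<^sup>*\<^bsub>?H\<^esub> x}"
      have "?A \<subseteq> verts G" using H.reachable_in_verts(2) by (auto simp: verts)
      moreover have "u \<in> ?A" using uv by (simp add: verts)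
      moreover have "\<forall>e\<in>arcs G. tail G e \<in> ?A \<longleftrightarrow> head G e \<in> ?A"
      proof
        fix e assume "e \<in> arcs G"
        from arcI[OF this] show "tail G e \<in> ?A \<longleftrightarrow> head G e \<in> ?A"
          using H.reachable_adj_trans by auto
      qed
      ultimately have "?A = verts G" using * by blast
      then show ?thesis using uv by blast
    qed
    then show "Digraph_Component.connected G"
      using * by (simp add: Digraph_Component.connected_def strongly_connected_def verts)
  qed
qed

context pair_sym_digraph
begin

text \<open>Arcs come in opposite pairs, so closure in one direction already gives the
  other.\<close>

lemma connected_induce_iff_cut:
  "Digraph_Component.connected (with_proj G \<restriction> D) \<longleftrightarrow> D \<noteq> {} \<and>
    (\<forall>A\<subseteq>D. A \<noteq> {} \<longrightarrow> (\<forall>x\<in>A. \<forall>y\<in>D. (x, y) \<in> parcs G \<longrightarrow> y \<in> A) \<longrightarrow> A = D)"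
proof -
  interpret I: wf_digraph "with_proj G \<restriction> D" by (rule wellformed_induce_subgraph)
  have "(\<forall>e\<in>arcs (with_proj G \<restriction> D). fst e \<in> A \<longleftrightarrow> snd e \<in> A) \<longleftrightarrow>
      (\<forall>x\<in>A. \<forall>y\<in>D. (x, y) \<in> parcs G \<longrightarrow> y \<in> A)" if "A \<subseteq> D" for A
    using that arcs_symmetric by auto
  then show ?thesis
    unfolding I.connected_iff_cut by auto
qed

lemma connected_induce_nonempty:
  "Digraph_Component.connected (with_proj G \<restriction> D) \<Longrightarrow> D \<noteq> {}"
  unfolding connected_induce_iff_cut by (rule conjunct1)

lemma connected_crossing_arc:
  assumes "Digraph_Component.connected (with_proj G \<restriction> D)" "A \<subseteq> D" "A \<noteq> {}" "A \<noteq> D"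
  obtains x y where "x \<in> A" "y \<in> D - A" "(x, y) \<in> parcs G"
proof -
  have "\<not> (\<forall>x\<in>A. \<forall>y\<in>D. (x, y) \<in> parcs G \<longrightarrow> y \<in> A)"
    using assms(1)[unfolded connected_induce_iff_cut, THEN conjunct2, rule_format, of A] assms(2-)
    by blast
  then show ?thesis using that by blast
qed

lemma induce_pverts: "with_proj G \<restriction> pverts G = with_proj G"
  by (auto simp: induce_subgraph_def with_proj_def dest: in_arcsD1 in_arcsD2)

lemma connected_induce_pverts:
  "Digraph_Component.connected (with_proj G) \<Longrightarrow>
    Digraph_Component.connected (with_proj G \<restriction> pverts G)"
  by (simp add: induce_pverts)

lemma connected_singleton: "Digraph_Component.connected (with_proj G \<restriction> {v})"
  unfolding connected_induce_iff_cut by blast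

lemma connected_insert:
  assumes "Digraph_Component.connected (with_proj G \<restriction> D)" "u \<in> D" "(u, v) \<in> parcs G"
  shows "Digraph_Component.connected (with_proj G \<restriction> insert v D)"
  unfolding connected_induce_iff_cut
proof (intro conjI allI impI)
  fix A assume A: "A \<subseteq> insert v D" "A \<noteq> {}"
    and cl: "\<forall>x\<in>A. \<forall>y\<in>insert v D. (x, y) \<in> parcs G \<longrightarrow> y \<in> A"
  \<comment> \<open>If \<open>A\<close> contains \<open>v\<close>, then the arc back from
    \<open>v\<close> brings \<open>u\<close> into \<open>A\<close>.\<close>
  have "A \<inter> D \<noteq> {}" using A cl assms(2,3) arcs_symmetric by blast
  moreover have "A \<inter> D \<subseteq> D" "\<forall>x\<in>A \<inter> D. \<forall>y\<in>D. (x, y) \<in> parcs G \<longrightarrow> y \<in> A \<inter> D"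
    using cl by auto
  ultimately have "A \<inter> D = D"
    using assms(1) unfolding connected_induce_iff_cut by blast
  then show "A = insert v D" using A cl assms(2,3) by blast
qed simp

text \<open>An arc leaving the part of \<open>D\<close> with \<open>f\<close> below \<open>j\<close>
  raises \<open>f\<close> by at most one, so it ends at value exactly \<open>j\<close>. This will
  show that a connected set meets every layer between two of its own.\<close>

lemma connected_intermediate_value:
  fixes f :: "'a \<Rightarrow> nat"
  assumes "Digraph_Component.connected (with_proj G \<restriction> D)"
    and step: "\<And>x y. (x, y) \<in> parcs G \<Longrightarrow> f y \<le> Suc (f x)"
    and "x \<in> D" "f x \<le> j" "y \<in> D" "j \<le> f y"
  shows "\<exists>z\<in>D. f z = j"
proof (rule ccontr)
  assume no: "\<not> (\<exists>z\<in>D. f z = j)"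
  let ?A = "{z \<in> D. f z < j}"
  have A: "?A \<subseteq> D" "?A \<noteq> {}" "?A \<noteq> D" using no assms(3-6) by (force simp: order.order_iff_strict)+
  from connected_crossing_arc[OF assms(1) A] obtain a b
    where ab: "a \<in> ?A" "b \<in> D - ?A" "(a, b) \<in> parcs G" .
  have "f b = j" using step[OF ab(3)] ab(1,2) by auto
  then show False using no ab(2) by blast
qed

end

text \<open>A minimiser of \<open>f\<close> on a nonempty closed set can only be \<open>r\<close>,
  so every such set contains \<open>r\<close>. The complement of a closed set is closed too, and
  both cannot contain \<open>r\<close>.\<close>

lemma (in pair_sym_digraph) connected_if_descending:
  fixes f :: "'a \<Rightarrow> nat"
  assumes "r \<in> pverts G"
    and desc: "\<And>v. v \<in> pverts G \<Longrightarrow> v \<noteq> r \<Longrightarrow> \<exists>u. (v, u) \<in> parcs G \<and> f u < f v"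
  shows "Digraph_Component.connected (with_proj G)"
proof -
  have r: "r \<in> A" if A: "A \<subseteq> pverts G" "A \<noteq> {}"
    and closed: "\<forall>x\<in>A. \<forall>y\<in>pverts G. (x, y) \<in> parcs G \<longrightarrow> y \<in> A" for A
  proof -
    obtain a where a: "a \<in> A" "\<And>b. b \<in> A \<Longrightarrow> f a \<le> f b"
      using A(2) ex_has_least_nat[of "\<lambda>x. x \<in> A" _ f] by blast
    have "a = r"
    proof (rule ccontr)
      assume "a \<noteq> r"
      then obtain u where "(a, u) \<in> parcs G" "f u < f a" using desc a A by blast
      moreover from this have "u \<in> A" using closed a(1) in_arcsD2 by blast
      ultimately show False using a(2) by fastforce
    qed
    then show ?thesis using a by simp
  qed
  have "Digraph_Component.connected (with_proj G \<restriction> pverts G)"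
    unfolding connected_induce_iff_cut
  proof (intro conjI allI impI)
    show "pverts G \<noteq> {}" using assms(1) by blast
    fix A assume A: "A \<subseteq> pverts G" "A \<noteq> {}"
      and closed: "\<forall>x\<in>A. \<forall>y\<in>pverts G. (x, y) \<in> parcs G \<longrightarrow> y \<in> A"
    show "A = pverts G"
    proof (rule ccontr)
      assume "A \<noteq> pverts G"
      then have "pverts G - A \<noteq> {}" using A(1) by blast
      moreover have "\<forall>x\<in>pverts G - A. \<forall>y\<in>pverts G. (x, y) \<in> parcs G \<longrightarrow> y \<in> pverts G - A"
        using closed arcs_symmetric by blast
      ultimately have "r \<in> pverts G - A" by (intro r) auto
      then show False using r[OF A closed] by blast
    qed
  qed
  then show ?thesis by (simp add: induce_pverts)
qed

section \<open>Growing a dominating set\<close>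

context pair_graph
begin

lemma degree_eq: "degree G v = card (parcs G `` {v})"
proof -
  have "parcs G `` {v} = snd ` {e \<in> parcs G. fst e = v}" by force
  moreover have "inj_on snd {e \<in> parcs G. fst e = v}" by (auto simp: inj_on_def)
  ultimately show ?thesis
    by (simp add: degree_def out_degree_def out_arcs_def card_image)
qed

lemma card_closed_nbhd_vertex:
  assumes "v \<in> pverts G"
  shows "card (closed_nbhd G {v}) = Suc (degree G v)"
proof -
  have "finite (parcs G `` {v})" using pair_finite_arcs by (simp add: finite_Image)
  moreover have "v \<notin> parcs G `` {v}" using no_loops' by blast
  ultimately show ?thesis by (simp add: closed_nbhd_def degree_eq)
qed

lemma min_degree_le: "v \<in> pverts G \<Longrightarrow> min_degree G \<le> degree G v"
  unfolding min_degree_def using pair_finite_verts by (intro Min_le) auto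

lemma finite_closed_nbhd: "D \<subseteq> pverts G \<Longrightarrow> finite (closed_nbhd G D)"
  using closed_nbhd_subset pair_finite_verts finite_subset by metis

text \<open>The inequality is the bound of part (i) with \<open>n - |N\<^sup>2(D)|\<close> replaced
  by the size of the closed neighbourhood, and cleared of division and subtraction.\<close>

definition many_dominated :: "'a set \<Rightarrow> bool" where
  "many_dominated D \<longleftrightarrow> D \<subseteq> pverts G \<and> Digraph_Component.connected (with_proj G \<restriction> D) \<and>
     (card D + 2) * (min_degree G + 1) \<le> 3 * card (closed_nbhd G D)"

text \<open>For one vertex the inequality reads
  \<open>3 * (\<delta> + 1) \<le> 3 * (degree G v + 1)\<close>; this start is the source of the
  constant 2.\<close>

lemma many_dominated_vertex:
  assumes "v \<in> pverts G"
  shows "many_dominated {v}"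
  using assms min_degree_le[OF assms] card_closed_nbhd_vertex[OF assms] connected_singleton
  by (simp add: many_dominated_def)

lemma many_dominated_extend_path:
  assumes G: "Digraph_Component.connected (with_proj G)"
    and D: "many_dominated D" and notdom: "closed_nbhd G (closed_nbhd G D) \<noteq> pverts G"
  shows "\<exists>D'. many_dominated D' \<and> card (closed_nbhd G D) < card (closed_nbhd G D')"
proof -
  let ?N = "closed_nbhd G"
  have DV: "D \<subseteq> pverts G" and Dconn: "Digraph_Component.connected (with_proj G \<restriction> D)"
    and bound: "(card D + 2) * (min_degree G + 1) \<le> 3 * card (?N D)"
    using D by (auto simp: many_dominated_def)
  have "?N (?N D) \<noteq> {}"
    using connected_induce_nonempty[OF Dconn] by (auto simp: closed_nbhd_def)
  \<comment> \<open>An arc leaving the ball of radius 2 ends in a vertex \<open>v\<close> at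
    distance 3; \<open>x\<close>, \<open>y\<close>, \<open>z\<close> trace a shortest path from
    \<open>v\<close> back to \<open>D\<close>.\<close>
  from connected_crossing_arc[OF connected_induce_pverts[OF G]
      closed_nbhd_subset[OF closed_nbhd_subset[OF DV]] this notdom]
  obtain x v where xv: "x \<in> ?N (?N D)" "v \<in> pverts G" "(x, v) \<in> parcs G" "v \<notin> ?N (?N D)"
    by blast
  then have "x \<notin> ?N D" by (auto simp: closed_nbhd_def)
  then obtain y where y: "y \<in> ?N D" "(y, x) \<in> parcs G" "y \<notin> D"
    using xv by (auto simp: closed_nbhd_def)
  then obtain z where z: "z \<in> D" "(z, y) \<in> parcs G"
    by (auto simp: closed_nbhd_def)
  define D' where "D' = insert v (insert x (insert y D))"
  have "Digraph_Component.connected (with_proj G \<restriction> D')"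
    unfolding D'_def using Dconn z y xv by (blast intro: connected_insert)
  moreover have "D' \<subseteq> pverts G"
    unfolding D'_def using DV xv y by (auto dest: in_arcsD1 in_arcsD2)
  moreover have "card D' \<le> card D + 3"
    unfolding D'_def using finite_subset[OF DV pair_finite_verts]
    by (simp add: card_insert_if)
  moreover have ge: "card (?N D') \<ge> card (?N D) + (min_degree G + 1)"
  proof -
    \<comment> \<open>A common vertex would put \<open>v\<close> within distance 2 of
      \<open>D\<close>.\<close>
    have "?N D \<inter> ?N {v} = {}"
      using xv(4) arcs_symmetric unfolding closed_nbhd_def by blast
    then have "card (?N D \<union> ?N {v}) = card (?N D) + card (?N {v})"
      using finite_closed_nbhd DV xv(2) by (intro card_Un_disjoint) auto
    moreover have "?N D \<union> ?N {v} \<subseteq> ?N D'"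
      by (auto simp: D'_def closed_nbhd_def)
    then have "card (?N D \<union> ?N {v}) \<le> card (?N D')"
      using \<open>D' \<subseteq> pverts G\<close> finite_closed_nbhd by (intro card_mono) auto
    ultimately show ?thesis
      using min_degree_le[OF xv(2)] card_closed_nbhd_vertex[OF xv(2)] by linarith
  qed
  moreover have "(card D' + 2) * (min_degree G + 1) \<le> 3 * card (?N D')"
  proof -
    have "(card D' + 2) * (min_degree G + 1) \<le> (card D + 3 + 2) * (min_degree G + 1)"
      using \<open>card D' \<le> card D + 3\<close> by (intro mult_right_mono) auto
    also have "\<dots> = (card D + 2) * (min_degree G + 1) + 3 * (min_degree G + 1)"
      by (simp add: algebra_simps)
    also have "\<dots> \<le> 3 * card (?N D) + 3 * (min_degree G + 1)"
      using bound by (rule add_right_mono)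
    also have "\<dots> \<le> 3 * card (?N D')" using ge by simp
    finally show ?thesis .
  qed
  ultimately show ?thesis by (intro exI[of _ D']) (auto simp: many_dominated_def)
qed

lemma many_dominated_extend_two_way:
  assumes "min_degree G \<ge> 2" and D: "many_dominated D"
    and v: "v \<in> closed_nbhd G (closed_nbhd G D) - closed_nbhd G D"
    and few: "card {u \<in> closed_nbhd G D - D. (v, u) \<in> parcs G} < 2"
  shows "\<exists>D'. many_dominated D' \<and> card (closed_nbhd G D) < card (closed_nbhd G D')"
proof -
  let ?N = "closed_nbhd G"
  have DV: "D \<subseteq> pverts G" and Dconn: "Digraph_Component.connected (with_proj G \<restriction> D)"
    and bound: "(card D + 2) * (min_degree G + 1) \<le> 3 * card (?N D)"
    using D by (auto simp: many_dominated_def)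
  have vV: "v \<in> pverts G" using v closed_nbhd_subset[OF closed_nbhd_subset[OF DV]] by blast
  obtain y where y: "y \<in> ?N D" "(y, v) \<in> parcs G"
    using v by (auto simp: closed_nbhd_def)
  have "y \<notin> D" using v y by (auto simp: closed_nbhd_def)
  then obtain z where z: "z \<in> D" "(z, y) \<in> parcs G"
    using y by (auto simp: closed_nbhd_def)
  \<comment> \<open>Any common vertex is, like \<open>y\<close>, a neighbour of \<open>v\<close> in
    \<open>N\<^sup>1(D)\<close>, and there are fewer than two of these. Hence at most one vertex of
    the closed neighbourhood of \<open>v\<close> was already dominated.\<close>
  have only_y: "?N D \<inter> ?N {v} \<subseteq> {y}"
  proof
    fix u assume u: "u \<in> ?N D \<inter> ?N {v}"
    then have vu: "(v, u) \<in> parcs G" using v by (auto simp: closed_nbhd_def)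
    then have "u \<notin> D" using v arcs_symmetric by (auto simp: closed_nbhd_def)
    then have "{u, y} \<subseteq> {u \<in> ?N D - D. (v, u) \<in> parcs G}"
      using u vu y \<open>y \<notin> D\<close> arcs_symmetric by auto
    moreover have "finite {u \<in> ?N D - D. (v, u) \<in> parcs G}"
      using finite_closed_nbhd[OF DV] by simp
    ultimately have "card {u, y} \<le> card {u \<in> ?N D - D. (v, u) \<in> parcs G}"
      by (intro card_mono)
    then have "card {u, y} < 2" using few by linarith
    then show "u \<in> {y}" by (cases "u = y") auto
  qed
  define D' where "D' = insert v (insert y D)"
  have "Digraph_Component.connected (with_proj G \<restriction> D')"
    unfolding D'_def using Dconn z y by (blast intro: connected_insert)
  moreover have D'V: "D' \<subseteq> pverts G"
    unfolding D'_def using DV y by (auto dest: in_arcsD1 in_arcsD2)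
  moreover have card_D': "card D' \<le> card D + 2"
    unfolding D'_def using finite_subset[OF DV pair_finite_verts]
    by (simp add: card_insert_if)
  moreover have ge: "card (?N D') \<ge> card (?N D) + min_degree G"
  proof -
    have fin: "finite (?N D)" "finite (?N {v})" using finite_closed_nbhd DV vV by auto
    have "card (?N D \<union> ?N {v}) + card (?N D \<inter> ?N {v}) = card (?N D) + card (?N {v})"
      using fin by (rule card_Un_Int[symmetric])
    moreover have "card (?N D \<inter> ?N {v}) \<le> 1"
      using card_mono[OF _ only_y] by simp
    moreover have "?N D \<union> ?N {v} \<subseteq> ?N D'"
      by (auto simp: D'_def closed_nbhd_def)
    then have "card (?N D \<union> ?N {v}) \<le> card (?N D')"
      using D'V finite_closed_nbhd by (intro card_mono) auto
    ultimately show ?thesis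
      using min_degree_le[OF vV] card_closed_nbhd_vertex[OF vV] by linarith
  qed
  moreover have "(card D' + 2) * (min_degree G + 1) \<le> 3 * card (?N D')"
  proof -
    have "(card D' + 2) * (min_degree G + 1) \<le> (card D + 2 + 2) * (min_degree G + 1)"
      using card_D' by (intro mult_right_mono) auto
    also have "\<dots> = (card D + 2) * (min_degree G + 1) + 2 * (min_degree G + 1)"
      by (simp add: algebra_simps)
    also have "\<dots> \<le> 3 * card (?N D) + 3 * min_degree G"
      using bound assms(1) by (intro add_mono) auto
    also have "\<dots> \<le> 3 * card (?N D')" using ge by simp
    finally show ?thesis .
  qed
  ultimately show ?thesis
    using assms(1) by (intro exI[of _ D']) (auto simp: many_dominated_def)
qed

text \<open>One maximal set serves both upper bounds. The estimate keeps the closed neighbourhood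
  instead of the order, since part (i) subtracts the vertices at distance two.\<close>

lemma ex_two_way_set:
  assumes G: "Digraph_Component.connected (with_proj G)"
  shows "\<exists>D. connected_two_step_dominating G D \<and>
    (card D + 2) * (min_degree G + 1) \<le> 3 * card (closed_nbhd G D) \<and>
    (min_degree G \<ge> 2 \<longrightarrow> connected_two_way_two_step_dominating G D)"
proof -
  obtain v where "v \<in> pverts G"
    using connected_induce_nonempty[OF connected_induce_pverts[OF G]] by blast
  then have 1: "many_dominated {v}" by (rule many_dominated_vertex)
  have 2: "\<forall>D. many_dominated D \<longrightarrow> card (closed_nbhd G D) < Suc (card (pverts G))"
    using card_mono[OF pair_finite_verts closed_nbhd_subset]
    unfolding many_dominated_def less_Suc_eq_le by blast
  obtain D where D: "many_dominated D"
    and max: "\<And>D'. many_dominated D' \<Longrightarrow> card (closed_nbhd G D') \<le> card (closed_nbhd G D)"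
    using ex_has_greatest_nat[of many_dominated, OF 1 2] by blast
  have DV: "D \<subseteq> pverts G" using D by (simp add: many_dominated_def)
  have "closed_nbhd G (closed_nbhd G D) = pverts G"
    using many_dominated_extend_path[OF G D] max by (meson leD)
  then have dom: "connected_two_step_dominating G D"
    using D by (simp add: connected_two_step_dominating_def two_step_dominating_iff
        many_dominated_def)
  have "connected_two_way_two_step_dominating G D" if 2: "min_degree G \<ge> 2"
    unfolding connected_two_way_two_step_dominating_def
  proof (intro conjI ballI impI)
    \<comment> \<open>Minimum degree at least 2 excludes pendant vertices.\<close>
    show "v \<in> D" if "v \<in> pverts G" "degree G v = 1" for v
      using that min_degree_le[of v] 2 by simp
    show "2 \<le> card {u \<in> nbhd G 1 D. (v, u) \<in> parcs G}" if "v \<in> nbhd G 2 D" for v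
      using that many_dominated_extend_two_way[OF 2 D, of v] max
      unfolding nbhd_1_eq[OF DV] nbhd_2_eq[OF DV] by (meson leD leI)
  qed (rule dom)
  then show ?thesis using dom D by (auto simp: many_dominated_def)
qed

text \<open>The vertex set splits into the ball of radius 1 and the vertices at distance exactly
  2.\<close>

lemma card_nbhd_2:
  assumes "two_step_dominating G D"
  shows "card (closed_nbhd G D) + card (nbhd G 2 D) = order G"
proof -
  have DV: "D \<subseteq> pverts G" and N: "closed_nbhd G (closed_nbhd G D) = pverts G"
    using assms by (auto simp: two_step_dominating_iff)
  have "card (pverts G - closed_nbhd G D) = card (pverts G) - card (closed_nbhd G D)"
    using closed_nbhd_subset[OF DV] finite_closed_nbhd[OF DV] by (rule card_Diff_subset[rotated])
  moreover have "card (closed_nbhd G D) \<le> card (pverts G)"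
    using closed_nbhd_subset[OF DV] pair_finite_verts by (intro card_mono)
  ultimately show ?thesis by (simp add: nbhd_2_eq[OF DV] N order_def)
qed

text \<open>No vertex has distance 2 from the whole vertex set, so the two-way condition is
  vacuous.\<close>

lemma pverts_two_way:
  assumes "Digraph_Component.connected (with_proj G)"
  shows "connected_two_way_two_step_dominating G (pverts G)"
proof -
  have N: "closed_nbhd G (pverts G) = pverts G"
    using closed_nbhd_subset[of "pverts G"] by (auto simp: closed_nbhd_def)
  then show ?thesis
    using assms nbhd_2_eq[of "pverts G"]
    by (simp add: connected_two_way_two_step_dominating_def connected_two_step_dominating_def
        two_step_dominating_iff induce_pverts)
qed

end

section \<open>The two upper bounds over the reals\<close>

lemma real_bound_iff:
  "real a \<le> 3 * real b / (real d + 1) - 2 \<longleftrightarrow> (a + 2) * (d + 1) \<le> 3 * b"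
proof -
  have "real a \<le> 3 * real b / (real d + 1) - 2 \<longleftrightarrow>
      (real a + 2) * (real d + 1) \<le> 3 * real b"
    by (simp add: le_diff_eq pos_le_divide_eq)
  also have "\<dots> \<longleftrightarrow> real ((a + 2) * (d + 1)) \<le> real (3 * b)"
    by (simp add: algebra_simps)
  finally show ?thesis unfolding of_nat_le_iff .
qed

theorem two_step_upper_bound:
  assumes "connected_graph G"
  shows "\<exists>D. connected_two_step_dominating G D \<and>
    real (card D) \<le> 3 * (real (order G) - real (card (nbhd G 2 D))) / (real (min_degree G) + 1) - 2"
proof -
  interpret pair_graph G using assms by (simp add: connected_graph_def)
  obtain D where D: "connected_two_step_dominating G D"
    "(card D + 2) * (min_degree G + 1) \<le> 3 * card (closed_nbhd G D)"
    using ex_two_way_set assms by (auto simp: connected_graph_def)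
  moreover have "real (order G) - real (card (nbhd G 2 D)) = real (card (closed_nbhd G D))"
    using card_nbhd_2[of D] D by (simp add: connected_two_step_dominating_def flip: of_nat_add)
  ultimately show ?thesis using real_bound_iff by metis
qed

theorem two_way_two_step_upper_bound:
  assumes "connected_graph G" "order G \<ge> 4"
  shows "\<exists>D. connected_two_way_two_step_dominating G D \<and>
    real (card D) \<le> 3 * real (order G) / (real (min_degree G) + 1) - 2"
proof -
  interpret pair_graph G using assms by (simp add: connected_graph_def)
  have G: "Digraph_Component.connected (with_proj G)"
    using assms by (simp add: connected_graph_def)
  show ?thesis unfolding real_bound_iff
  proof (cases "min_degree G \<ge> 2")
    case True
    then obtain D where D: "connected_two_way_two_step_dominating G D"
      "(card D + 2) * (min_degree G + 1) \<le> 3 * card (closed_nbhd G D)"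
      using ex_two_way_set[OF G] by blast
    moreover have "card (closed_nbhd G D) \<le> order G"
      using card_nbhd_2[of D] D(1)
      by (simp add: connected_two_step_dominating_def connected_two_way_two_step_dominating_def)
    ultimately show "\<exists>D. connected_two_way_two_step_dominating G D \<and>
        (card D + 2) * (min_degree G + 1) \<le> 3 * order G"
      by (intro exI[of _ D]) auto
  next
    case False
    then have "(order G + 2) * (min_degree G + 1) \<le> (order G + 2) * 2"
      by (intro mult_left_mono) auto
    \<comment> \<open>\<open>(n + 2) * 2 \<le> 3 * n\<close> holds exactly for
      \<open>n \<ge> 4\<close>.\<close>
    also have "\<dots> \<le> 3 * order G" using assms(2) by simp
    finally show "\<exists>D. connected_two_way_two_step_dominating G D \<and>
        (card D + 2) * (min_degree G + 1) \<le> 3 * order G"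
      using pverts_two_way[OF G] by (intro exI[of _ "pverts G"]) (simp add: order_def)
  qed
qed

section \<open>A layered graph\<close>

text \<open>
  The vertices below \<open>(m + 2) * (d + 1)\<close> form \<open>m + 2\<close> consecutive blocks, each split into layers of
  sizes \<open>1, d - 1, 1\<close>. The two extra vertices enlarge the second and the second to last layer, so
  that the end vertices, which miss one of the three layers seen by an inner vertex, still have
  degree \<open>d\<close>.
\<close>

definition layer :: "nat \<Rightarrow> nat \<Rightarrow> nat \<Rightarrow> nat" where
  "layer d m v =
    (if v = (m + 2) * (d + 1) then 1
     else if v = (m + 2) * (d + 1) + 1 then 3 * m + 4
     else 3 * (v div (d + 1)) +
       (if v mod (d + 1) = 0 then 0 else if v mod (d + 1) = d then 2 else 1))"

definition layered_graph :: "nat \<Rightarrow> nat \<Rightarrow> nat pair_pre_digraph" where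
  "layered_graph d m =
    \<lparr> pverts = {..<(m + 2) * (d + 1) + 2},
      parcs = {(u, v). u < (m + 2) * (d + 1) + 2 \<and> v < (m + 2) * (d + 1) + 2 \<and> u \<noteq> v \<and>
        layer d m u \<le> Suc (layer d m v) \<and> layer d m v \<le> Suc (layer d m u)} \<rparr>"

lemma pverts_layered_graph: "pverts (layered_graph d m) = {..<(m + 2) * (d + 1) + 2}"
  by (simp add: layered_graph_def)

lemma parcs_layered_graph:
  "(u, v) \<in> parcs (layered_graph d m) \<longleftrightarrow>
    u < (m + 2) * (d + 1) + 2 \<and> v < (m + 2) * (d + 1) + 2 \<and> u \<noteq> v \<and>
    layer d m u \<le> Suc (layer d m v) \<and> layer d m v \<le> Suc (layer d m u)"
  by (simp add: layered_graph_def)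

lemma order_layered_graph: "order (layered_graph d m) = (m + 2) * (d + 1) + 2"
  by (simp add: order_def pverts_layered_graph)

lemma pair_graph_layered_graph: "pair_graph (layered_graph d m)"
proof
  let ?G = "layered_graph d m"
  have "parcs ?G \<subseteq> pverts ?G \<times> pverts ?G"
    by (auto simp: parcs_layered_graph pverts_layered_graph)
  then show "finite (parcs ?G)"
    by (rule finite_subset) (simp add: pverts_layered_graph)
  show "symmetric (with_proj ?G)"
    by (auto simp: symmetric_def sym_def parcs_layered_graph)
qed (auto simp: parcs_layered_graph pverts_layered_graph)

lemma block_index_less:
  fixes q r m d :: nat
  assumes "q < m + 2" "r \<le> d"
  shows "q * (d + 1) + r < (m + 2) * (d + 1)"
proof -
  have "q * (d + 1) + r < (q + 1) * (d + 1)" using assms by simp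
  also have "\<dots> \<le> (m + 2) * (d + 1)" using assms by (intro mult_right_mono) auto
  finally show ?thesis .
qed

lemma layer_block:
  assumes "q < m + 2" "r \<le> d"
  shows "layer d m (q * (d + 1) + r) = 3 * q + (if r = 0 then 0 else if r = d then 2 else 1)"
proof -
  have "(q * (d + 1) + r) div (d + 1) = q" "(q * (d + 1) + r) mod (d + 1) = r"
    using assms(2) by (simp_all only: div_mult_self3 mod_mult_self3 div_less mod_less
        less_Suc_eq_le Suc_eq_plus1[symmetric] nat.distinct add_0_right simp_thms)
  then show ?thesis
    using block_index_less[OF assms] unfolding layer_def by simp
qed

lemma layer_extra:
  "layer d m ((m + 2) * (d + 1)) = 1"
  "layer d m ((m + 2) * (d + 1) + 1) = 3 * m + 4"
  by (simp_all add: layer_def)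

lemma layered_vertex_cases:
  fixes v m d :: nat
  assumes "v < (m + 2) * (d + 1) + 2"
  obtains (block) q r where "q < m + 2" "r \<le> d" "v = q * (d + 1) + r"
    | (first) "v = (m + 2) * (d + 1)"
    | (last) "v = (m + 2) * (d + 1) + 1"
proof (cases "v < (m + 2) * (d + 1)")
  case True
  then have "v div (d + 1) < m + 2" by (simp add: less_mult_imp_div_less)
  moreover have "v mod (d + 1) \<le> d" using mod_less_divisor[of "d + 1" v] by simp
  moreover have "v = v div (d + 1) * (d + 1) + v mod (d + 1)" by (rule div_mult_mod_eq[symmetric])
  ultimately show ?thesis by (rule block)
next
  case False
  then consider "v = (m + 2) * (d + 1)" | "v = (m + 2) * (d + 1) + 1" using assms by linarith
  then show ?thesis using first last by cases
qed

lemma layer_less: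
  assumes "v < (m + 2) * (d + 1) + 2"
  shows "layer d m v < 3 * (m + 2)"
  using assms
proof (cases rule: layered_vertex_cases)
  case (block q r)
  then show ?thesis using layer_block[of q m r d] by auto
qed (simp_all only: layer_extra, simp_all)

text \<open>The offsets 0, 1 and \<open>d\<close> represent the three layers of a block; they are
  distinct because \<open>2 \<le> d\<close>.\<close>

lemma ex_layer:
  assumes "2 \<le> d" "i < 3 * (m + 2)"
  shows "\<exists>u<(m + 2) * (d + 1). layer d m u = i"
proof -
  define r where "r = (if i mod 3 = 0 then 0 else if i mod 3 = 1 then 1 else d)"
  have q: "i div 3 < m + 2" and r: "r \<le> d" using assms by (auto simp: r_def)
  have "3 * (i div 3) + (if r = 0 then 0 else if r = d then 2 else 1) = i"
  proof -
    have "i mod 3 < 3" by simp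
    then consider "i mod 3 = 0" | "i mod 3 = 1" | "i mod 3 = 2" by linarith
    then show ?thesis
      using div_mult_mod_eq[of i 3] assms(1) by cases (auto simp: r_def)
  qed
  then have "layer d m (i div 3 * (d + 1) + r) = i" using layer_block[OF q r] by simp
  then show ?thesis using block_index_less[OF q r] by blast
qed

text \<open>Vertex 0 alone forms the lowest layer. It is the root for connectedness and later
  attains the minimum degree.\<close>

lemma layer_eq_0_iff:
  assumes "2 \<le> d" "v < (m + 2) * (d + 1) + 2"
  shows "layer d m v = 0 \<longleftrightarrow> v = 0"
  using assms(2)
proof (cases rule: layered_vertex_cases)
  case (block q r)
  then show ?thesis using layer_block[of q m r d] assms(1) by auto
qed (simp_all only: layer_extra, simp_all)

section \<open>Connectedness and minimum degree of the layered graph\<close>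

lemma connected_layered_graph:
  assumes "2 \<le> d"
  shows "Digraph_Component.connected (with_proj (layered_graph d m))"
proof -
  interpret pair_graph "layered_graph d m" by (rule pair_graph_layered_graph)
  show ?thesis
  \<comment> \<open>No layer is empty, so every vertex other than 0 has a neighbour one layer
    below.\<close>
  proof (rule connected_if_descending[of 0 "layer d m"])
    show "0 \<in> pverts (layered_graph d m)" by (simp add: pverts_layered_graph)
    fix v assume "v \<in> pverts (layered_graph d m)" "v \<noteq> 0"
    then have v: "v < (m + 2) * (d + 1) + 2" and pos: "layer d m v \<noteq> 0"
      using layer_eq_0_iff[OF assms] by (auto simp: pverts_layered_graph)
    obtain u where u: "u < (m + 2) * (d + 1)" "layer d m u = layer d m v - 1"
      using ex_layer[OF assms less_imp_diff_less[OF layer_less[OF v]]] by blast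
    then have "layer d m v = Suc (layer d m u)" using pos by simp
    then show "\<exists>u. (v, u) \<in> parcs (layered_graph d m) \<and> layer d m u < layer d m v"
      using u v by (intro exI[of _ u]) (auto simp: parcs_layered_graph)
  qed
qed

lemma closed_nbhd_layered_graph:
  assumes "v < (m + 2) * (d + 1) + 2"
  shows "closed_nbhd (layered_graph d m) {v} = {u. u < (m + 2) * (d + 1) + 2 \<and>
    layer d m v \<le> Suc (layer d m u) \<and> layer d m u \<le> Suc (layer d m v)}"
  using assms by (auto simp: closed_nbhd_def parcs_layered_graph)

text \<open>
  The first layer of a block trades the last layer for that of the previous block, and
  symmetrically; at both ends of the graph an extra vertex takes this role.
\<close>

lemma ex_near_layers:
  assumes d: "2 \<le> d" and v: "v < (m + 2) * (d + 1) + 2"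
  shows "\<exists>S\<subseteq>{..<(m + 2) * (d + 1) + 2}. card S = d + 1 \<and>
    (\<forall>u\<in>S. layer d m v \<le> Suc (layer d m u) \<and> layer d m u \<le> Suc (layer d m v))"
proof -
  define N where "N = (m + 2) * (d + 1)"
  define block where "block q r = q * (d + 1) + r" for q r
  define near where
    "near u \<longleftrightarrow> layer d m v \<le> Suc (layer d m u) \<and> layer d m u \<le> Suc (layer d m v)" for u
  have block_less: "block q r < N" if "q < m + 2" "r \<le> d" for q r
    using block_index_less[OF that] by (simp only: block_def N_def)
  have layer_block': "layer d m (block q r) = 3 * q + (if r = 0 then 0 else if r = d then 2 else 1)"
    if "q < m + 2" "r \<le> d" for q r
    using layer_block[OF that] by (simp only: block_def)
  have card_block: "card (block q ` I) = card I" for q I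
    by (intro card_image) (auto simp: inj_on_def block_def)
  have extra: "layer d m N = 1" "layer d m (N + 1) = 3 * m + 4"
    unfolding N_def by (rule layer_extra)+
  \<comment> \<open>A vertex in the middle layer of a block sees the whole block. This covers the
    extra vertices as well: layers 1 and \<open>3 * m + 4\<close> are the middle layers of the first
    and the last block.\<close>
  have whole: "\<exists>S\<subseteq>{..<N + 2}. card S = d + 1 \<and> Ball S near"
    if "q < m + 2" "layer d m v = 3 * q + 1" for q
  proof (intro exI[of _ "block q ` {..d}"] conjI)
    show "block q ` {..d} \<subseteq> {..<N + 2}" using block_less[OF that(1)] by fastforce
    show "Ball (block q ` {..d}) near" using layer_block'[OF that(1)] that(2) by (auto simp: near_def)
  qed (simp add: card_block)
  \<comment> \<open>A vertex in an end layer sees only \<open>d\<close> vertices of its own block,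
    those with offsets in \<open>I\<close>; \<open>w\<close> is the replacement for the missing
    one.\<close>
  have exchange: "\<exists>S\<subseteq>{..<N + 2}. card S = d + 1 \<and> Ball S near"
    if "q < m + 2" "I \<subseteq> {..d}" "card I = d" "w < N + 2" "w \<notin> block q ` I" "near w"
      "\<And>r. r \<in> I \<Longrightarrow> near (block q r)" for q w I
  proof (intro exI[of _ "insert w (block q ` I)"] conjI)
    have "finite I" using that(2) finite_subset by blast
    then show "card (insert w (block q ` I)) = d + 1" using that(3,5) by (simp add: card_block)
    show "insert w (block q ` I) \<subseteq> {..<N + 2}" using block_less[OF that(1)] that(2,4) by fastforce
    show "Ball (insert w (block q ` I)) near" using that(6,7) by blast
  qed
  have "\<exists>S\<subseteq>{..<N + 2}. card S = d + 1 \<and> Ball S near"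
    using v
  proof (cases rule: layered_vertex_cases)
    case first
    then show ?thesis using whole[of 0] extra by (simp add: N_def)
  next
    case last
    then show ?thesis using whole[of "m + 1"] extra by (simp add: N_def)
  next
    case (block q r)
    then have v_eq: "v = block q r" by (simp add: block_def)
    note q = \<open>q < m + 2\<close>
    have lv: "layer d m v = 3 * q + (if r = 0 then 0 else if r = d then 2 else 1)"
      using layer_block'[OF block(1,2)] v_eq by simp
    have lB: "layer d m (block q r') = 3 * q + (if r' = 0 then 0 else if r' = d then 2 else 1)"
      if "r' \<le> d" for r' using layer_block'[OF q that] .
    \<comment> \<open>The replacement is new for one of two reasons: its index lies beyond all
      blocks, as for the extra vertices, or its layer is none of the three layers of the
      block.\<close>
    have fresh: "w \<notin> block q ` I" if "I \<subseteq> {..d}" "N \<le> w" for w I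
    proof
      assume "w \<in> block q ` I"
      then obtain i where "i \<in> I" "w = block q i" by blast
      then show False using block_less[OF q, of i] that by auto
    qed
    have fresh_layer: "w \<notin> block q ` I"
      if "I \<subseteq> {..d}" "layer d m w < 3 * q \<or> 3 * q + 2 < layer d m w" for w I
    proof
      assume "w \<in> block q ` I"
      then obtain i where "i \<in> I" "w = block q i" by blast
      then show False using lB[of i] that by (auto split: if_splits)
    qed
    \<comment> \<open>First layer at the left end or further inside, last layer at the right end or
      further inside, middle layer. Replacements come from an extra vertex at the ends and from the
      adjacent block inside.\<close>
    consider "r = 0" "q = 0" | "r = 0" "0 < q" | "r = d" "q = m + 1"
      | "r = d" "Suc q < m + 2" | "0 < r" "r < d"
      using q \<open>r \<le> d\<close> by linarith
    then show ?thesis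
    proof cases
      case 1
      have "N \<notin> block q ` {..<d}" by (intro fresh) auto
      then show ?thesis
        using 1 lv lB extra d by (intro exchange[OF q, of "{..<d}" N]) (auto simp: near_def)
    next
      case 2
      then obtain p where p: "q = Suc p" by (cases q) auto
      have w: "layer d m (block p d) = 3 * p + 2" "block p d < N"
        using layer_block'[of p d] block_less[of p d] p q d by auto
      have "block p d \<notin> block q ` {..<d}" by (intro fresh_layer) (use w p in auto)
      then show ?thesis
        using 2 p lv lB w d by (intro exchange[OF q, of "{..<d}" "block p d"]) (auto simp: near_def)
    next
      case 3
      have "N + 1 \<notin> block q ` {1..d}" by (intro fresh) auto
      then show ?thesis
        using 3 lv lB extra d by (intro exchange[OF q, of "{1..d}" "N + 1"]) (auto simp: near_def)
    next
      case 4
      have w: "layer d m (block (Suc q) 0) = 3 * q + 3" "block (Suc q) 0 < N"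
        using layer_block'[of "Suc q" 0] block_less[of "Suc q" 0] 4 by auto
      have "block (Suc q) 0 \<notin> block q ` {1..d}" by (intro fresh_layer) (use w in auto)
      then show ?thesis
        using 4 lv lB w d by (intro exchange[OF q, of "{1..d}" "block (Suc q) 0"]) (auto simp: near_def)
    next
      case 5
      then show ?thesis using whole[OF q] lv by simp
    qed
  qed
  then show ?thesis by (auto simp: N_def near_def Ball_def)
qed

lemma min_degree_layered_graph:
  assumes d: "2 \<le> d"
  shows "min_degree (layered_graph d m) = d"
proof -
  let ?G = "layered_graph d m" and ?N = "(m + 2) * (d + 1)"
  interpret pair_graph ?G by (rule pair_graph_layered_graph)
  have ge: "d \<le> degree ?G v" if "v \<in> pverts ?G" for v
  proof -
    have v: "v < ?N + 2" using that by (simp add: pverts_layered_graph)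
    obtain S where "S \<subseteq> closed_nbhd ?G {v}" "card S = d + 1"
      using ex_near_layers[OF d v] unfolding closed_nbhd_layered_graph[OF v] by blast
    then have "d + 1 \<le> card (closed_nbhd ?G {v})"
      using card_mono[OF finite_closed_nbhd, of "{v}" S] that by auto
    then show ?thesis using card_closed_nbhd_vertex[OF that] by simp
  qed
  have 0: "0 \<in> pverts ?G" by (simp add: pverts_layered_graph)
  \<comment> \<open>Layers 0 and 1 consist of the first block without its last vertex, together with
    one extra vertex: \<open>d + 1\<close> vertices in all.\<close>
  have "closed_nbhd ?G {0} \<subseteq> insert ?N {..<d}"
  proof
    fix u assume "u \<in> closed_nbhd ?G {0}"
    then have u: "u < ?N + 2" "layer d m u \<le> 1"
      using layer_eq_0_iff[OF d, of 0 m] by (auto simp: closed_nbhd_layered_graph)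
    from u(1) show "u \<in> insert ?N {..<d}"
    proof (cases rule: layered_vertex_cases)
      case (block q r)
      then have "3 * q + (if r = 0 then 0 else if r = d then 2 else 1) \<le> 1"
        using layer_block[OF block(1,2)] u(2) by simp
      then have "q = 0" "r \<noteq> d" using d by (auto split: if_splits)
      then show ?thesis using block by simp
    qed (use u(2) layer_extra(2)[of d m] in auto)
  qed
  then have "card (closed_nbhd ?G {0}) \<le> card (insert ?N {..<d})"
    by (intro card_mono) auto
  also have "\<dots> \<le> d + 1" by (simp add: card_insert_if)
  finally have "degree ?G 0 \<le> d" using card_closed_nbhd_vertex[OF 0] by simp
  then have "degree ?G 0 = d" using ge[OF 0] by simp
  then show ?thesis
    unfolding min_degree_def using ge 0 pair_finite_verts
    by (intro Min_eqI) (auto intro: rev_image_eqI)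
qed

section \<open>Connected two-step dominating sets of the layered graph\<close>

lemma gamma2c_layered_graph:
  assumes d: "2 \<le> d"
  shows "3 * m + 2 \<le> gamma2c (layered_graph d m)"
proof -
  let ?G = "layered_graph d m" and ?N = "(m + 2) * (d + 1)"
  interpret pair_graph ?G by (rule pair_graph_layered_graph)
  have near: "\<exists>u\<in>D. layer d m v \<le> layer d m u + 1 \<and> layer d m u \<le> layer d m v + 1"
    if "v \<in> closed_nbhd ?G D" for v D
  proof (cases "v \<in> D")
    case False
    then show ?thesis using that by (auto simp: closed_nbhd_def parcs_layered_graph)
  qed (intro bexI[of _ v], simp_all)
  have bound: "3 * m + 2 \<le> card D" if D: "connected_two_step_dominating ?G D" for D
  proof -
    have DV: "D \<subseteq> pverts ?G" and conn: "Digraph_Component.connected (with_proj ?G \<restriction> D)"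
      and dom: "closed_nbhd ?G (closed_nbhd ?G D) = pverts ?G"
      using D by (auto simp: connected_two_step_dominating_def two_step_dominating_iff)
    have near2: "\<exists>u\<in>D. layer d m v \<le> layer d m u + 2 \<and> layer d m u \<le> layer d m v + 2"
      if "v < ?N + 2" for v
    proof -
      have "v \<in> closed_nbhd ?G (closed_nbhd ?G D)" using that dom by (simp add: pverts_layered_graph)
      from near[OF this] obtain w where w: "w \<in> closed_nbhd ?G D"
        "layer d m v \<le> layer d m w + 1" "layer d m w \<le> layer d m v + 1" by blast
      from near[OF w(1)] obtain u where "u \<in> D"
        "layer d m w \<le> layer d m u + 1" "layer d m u \<le> layer d m w + 1" by blast
      then show ?thesis using w by (intro bexI[of _ u]) auto
    qed
    \<comment> \<open>The layers run from 0 to \<open>3 * m + 5\<close>. Dominating both ends within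
      two steps forces vertices of \<open>D\<close> in layers at most 2 and at least
      \<open>3 * m + 3\<close>; connectedness fills the \<open>3 * m + 2\<close> layers from 2 to
      \<open>3 * m + 3\<close>.\<close>
    obtain x where x: "x \<in> D" "layer d m x \<le> 2"
      using near2[of 0] layer_eq_0_iff[OF d, of 0 m] by auto
    obtain t where "t < ?N" "layer d m t = 3 * m + 5" using ex_layer[OF d, of "3 * m + 5" m] by auto
    then obtain y where y: "y \<in> D" "3 * m + 3 \<le> layer d m y" using near2[of t] by auto
    have "j \<in> layer d m ` D" if "j \<in> {2..3 * m + 3}" for j
      using connected_intermediate_value[OF conn, of "layer d m" x j y] x y that
      by (auto simp: parcs_layered_graph)
    then have "{2..3 * m + 3} \<subseteq> layer d m ` D" by blast
    then have "card {2..3 * m + 3} \<le> card D"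
      using finite_subset[OF DV pair_finite_verts] surj_card_le by blast
    then show ?thesis by simp
  qed
  \<comment> \<open>\<open>gamma2c\<close> is a \<open>Min\<close>, so the candidate sets must be
    shown to exist and to be finite in number.\<close>
  have "connected_two_step_dominating ?G (pverts ?G)"
    using pverts_two_way[OF connected_layered_graph[OF d]]
    by (simp add: connected_two_way_two_step_dominating_def)
  moreover have "{D. connected_two_step_dominating ?G D} \<subseteq> Pow (pverts ?G)"
    by (auto simp: connected_two_step_dominating_def two_step_dominating_def)
  then have "finite {D. connected_two_step_dominating ?G D}"
    using pair_finite_verts finite_subset by blast
  ultimately show ?thesis
    unfolding gamma2c_def using bound by (intro Min.boundedI) auto
qed

text \<open>An isomorphism is injective on vertices and maps onto those of \<open>H\<close>. The
  order will tell the members of the family apart.\<close>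

lemma digraph_iso_order_eq:
  assumes "digraph_iso (with_proj G) (with_proj H)"
  shows "order G = order H"
proof -
  obtain f where f: "pre_digraph.digraph_isomorphism (with_proj G) f"
    and H: "with_proj H = app_iso f (with_proj G)"
    using assms by (auto simp: digraph_iso_def)
  have "pverts H = iso_verts f ` pverts G"
    using arg_cong[OF H, of verts] by simp
  moreover have "inj_on (iso_verts f) (pverts G)"
    using pre_digraph.digraph_isomorphism_inj_on_verts[OF f] by simp
  ultimately show ?thesis by (simp add: order_def card_image)
qed

theorem two_step_lower_bound:
  assumes "2 \<le> \<delta>"
  shows "\<exists>\<G> :: nat pair_pre_digraph set.
    infinite \<G> \<and>
    pairwise (\<lambda>G H. \<not> digraph_iso (with_proj G) (with_proj H)) \<G> \<and>
    (\<forall>G\<in>\<G>. connected_graph G \<and> min_degree G = \<delta> \<and>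
      real (gamma2c G) \<ge> 3 * (real (order G) - 2) / (real \<delta> + 1) - 4)"
proof (intro exI[of _ "range (layered_graph \<delta>)"] conjI ballI)
  \<comment> \<open>Since the order determines \<open>m\<close>, the family is infinite and its
    distinct members are not isomorphic.\<close>
  have inj: "m = m'" if "order (layered_graph \<delta> m) = order (layered_graph \<delta> m')" for m m'
    using that by (simp only: order_layered_graph add_right_cancel mult_cancel2) simp
  then have "inj (layered_graph \<delta>)" by (intro injI) auto
  then show "infinite (range (layered_graph \<delta>))" by (rule range_inj_infinite)
  show "pairwise (\<lambda>G H. \<not> digraph_iso (with_proj G) (with_proj H)) (range (layered_graph \<delta>))"
    using inj digraph_iso_order_eq by (fastforce simp: pairwise_def)
  fix G assume "G \<in> range (layered_graph \<delta>)"
  then obtain m where [simp]: "G = layered_graph \<delta> m" by blast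
  show "connected_graph G"
    using connected_layered_graph[OF assms] pair_graph_layered_graph
    by (simp add: connected_graph_def)
  show "min_degree G = \<delta>" using min_degree_layered_graph[OF assms] by simp
  \<comment> \<open>Without the two extra vertices the order is
    \<open>(m + 2) * (\<delta> + 1)\<close>, so the quotient is \<open>3 * (m + 2)\<close>.\<close>
  have "3 * (real (order G) - 2) / (real \<delta> + 1) - 4 = real (3 * m + 2)"
    by (simp add: order_layered_graph field_simps)
  then show "real (gamma2c G) \<ge> 3 * (real (order G) - 2) / (real \<delta> + 1) - 4"
    using gamma2c_layered_graph[OF assms, of m] by simp
qed

theorem theorem6:
  shows "(\<forall>G :: 'a pair_pre_digraph. connected_graph G \<longrightarrow>
            (\<exists>D. connected_two_step_dominating G D \<and>
                 real (card D) \<le> 3 * (real (order G) - real (card (nbhd G 2 D)))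
                                   / (real (min_degree G) + 1) - 2))
       \<and> (\<forall>G :: 'a pair_pre_digraph. connected_graph G \<and> order G \<ge> 4 \<longrightarrow>
            (\<exists>D. connected_two_way_two_step_dominating G D \<and>
                 real (card D) \<le> 3 * real (order G) / (real (min_degree G) + 1) - 2))
       \<and> (\<forall>\<delta>::nat. \<delta> \<ge> 2 \<longrightarrow>
            (\<exists>\<G> :: nat pair_pre_digraph set.
                 infinite \<G> \<and>
                 pairwise (\<lambda>G H. \<not> digraph_iso (with_proj G) (with_proj H)) \<G> \<and>
                 (\<forall>G\<in>\<G>. connected_graph G \<and> min_degree G = \<delta> \<and>
                    real (gamma2c G) \<ge> 3 * (real (order G) - 2) / (real \<delta> + 1) - 4)))"
  using two_step_upper_bound two_way_two_step_upper_bound two_step_lower_bound by blast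

end
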